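(* Let $\mathcal{A} \in \mathbb{R}^{I_1 \times J \times K_1}$, $\mathcal{B} \in \mathbb{R}^{K_1 \times R \times L_1}$, $\mathcal{C} \in \mathbb{R}^{I_2 \times J \times K_2}$ and $\mathcal{D} \in \mathbb{R}^{K_2 \times R \times L_2}$ be 3rd-order tensors. Then $$(\mathcal{A} \boxtimes_2 \mathcal{B})_{[2]}^{\top} (\mathcal{C} \boxtimes_2 \mathcal{D})_{[2]} = \left( \Big(\sum_{r=1}^{R} \mathbf{B}(r)^{\top} \circ \mathbf{D}(r)^{\top}\Big) \times_{2,4}^{1,3} \Big(\sum_{j=1}^{J} \mathbf{A}(j)^{\top} \circ \mathbf{C}(j)^{\top}\Big) \right)_{<2>}.$$
   Context: All tensors and matrices are real. For a positive integer $I$, $[I]=\{1,\dots,I\}$. For indices $i_1\in[I_1],\dots,i_N\in[I_N]$, the combined index is $\overline{i_1 i_2\cdots i_N} = 1+\sum_{n=1}^N (i_n-1)\prod_{j=1}^{n-1} I_j$. Lateral slices: for a 3rd-order tensor $\mathcal{A}\in\mathbb{R}^{I\times J\times K}$, $\mathbf{A}(j)=\mathcal{A}(:,j,:)\in\mathbb{R}^{I\times K}$ is its $j$-th lateral slice (similarly $\mathbf{B}(r)$, $\mathbf{C}(j)$, $\mathbf{D}(r)$ for $\mathcal{B},\mathcal{C},\mathcal{D}$). Mode-2 subchain product: for $\mathcal{A}\in\mathbb{R}^{I_1\times J_1\times K}$ and $\mathcal{B}\in\mathbb{R}^{K\times J_2\times I_2}$, $\mathcal{A}\boxtimes_2\mathcal{B}$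 is the tensor of size $I_1\times J_1J_2\times I_2$ whose lateral slices are the matrix products $(\mathcal{A}\boxtimes_2\mathcal{B})(\overline{j_1j_2})=\mathbf{A}(j_1)\mathbf{B}(j_2)$. Mode-$n$ unfolding: for $\mathcal{X}\in\mathbb{R}^{I_1\times\cdots\times I_N}$, $\mathbf{X}_{[n]}$ is the $I_n\times\prod_{j\ne n}I_j$ matrix with $\mathbf{X}_{[n]}(i_n,\overline{i_{n+1}\cdots i_N i_1\cdots i_{n-1}})=\mathcal{X}(i_1,\dots,i_N)$. In particular, for $N=3$, $\mathbf{X}_{[2]}(i_2,\overline{i_3 i_1})=\mathcal{X}(i_1,i_2,i_3)$. $n$-unfolding: $\mathbf{X}_{<n>}$ is the $\prod_{j=1}^n I_j\times\prod_{j=n+1}^N I_j$ matrix with $\mathbf{X}_{<n>}(\overline{i_1\cdots i_n},\overline{i_{n+1}\cdots i_N})=\mathcal{X}(i_1,\dots,i_N)$. Outer product: for $\mathcal{A}\in\mathbb{R}^{I_1\times\cdots\times I_N}$ and $\mathcal{B}\in\mathbb{R}^{J_1\times\cdots\times J_M}$, $(\mathcal{A}\circ\mathcal{B})(i_1,\dots,i_N,j_1,\dots,j_M)=\mathcal{A}(i_1,\dots,i_N)\,\mathcal{B}(j_1,\dots,j_M)$. General contracted tensor product: for $\mathcal{A}\in\mathbb{R}^{I_1\times J\times R_1\times K}$ and $\mathcal{B}\in\mathbb{R}^{J\times I_2\times K\times R_2}$, $\mathcal{A}\times_{2,4}^{1,3}\mathcal{B}$ is the tensor of size $I_1\times I_2\times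 R_1\times R_2$ with $(\mathcal{A}\times_{2,4}^{1,3}\mathcal{B})(i_1,i_2,r_1,r_2)=\sum_{j,k}\mathcal{A}(i_1,j,r_1,k)\,\mathcal{B}(j,i_2,k,r_2)$. *)

theory Defs
  imports Jordan_Normal_Form.Matrix
begin

text \<open>
  A real tensor of order \<open>N\<close> is a list of \<open>N\<close> dimensions together with its entries, indexed by
  lists of length \<open>N\<close>. As for \<^typ>\<open>real mat\<close>, all indices start at \<open>0\<close>, so \<open>i \<in> [I]\<close>
  becomes \<open>i < I\<close>. Entries outside the index range are fixed, so that equality of tensors is
  equality of dimensions and of in-range entries.
\<close>

definition indices :: "nat list \<Rightarrow> nat list set" where
  "indices ds = {is. list_all2 (<) is ds}"

typedef tensor = "{(ds :: nat list, f :: nat list \<Rightarrow> real). f \<in> extensional (indices ds)}"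
  by (rule exI[of _ "([], \<lambda>_. undefined)"]) (auto simp: extensional_def)

setup_lifting type_definition_tensor

lift_definition dims :: "tensor \<Rightarrow> nat list" is fst .

lift_definition entry :: "tensor \<Rightarrow> nat list \<Rightarrow> real" is snd .

lift_definition tensor :: "nat list \<Rightarrow> (nat list \<Rightarrow> real) \<Rightarrow> tensor"
  is "\<lambda>ds f. (ds, restrict f (indices ds))"
  by auto

lemma dims_tensor [simp]: "dims (tensor ds f) = ds"
  by transfer simp

lemma entry_tensor [simp]: "is \<in> indices ds \<Longrightarrow> entry (tensor ds f) is = f is"
  by transfer simp

lemma tensor_eqI:
  assumes "dims X = dims Y" and "\<And>is. is \<in> indices (dims X) \<Longrightarrow> entry X is = entry Y is"
  shows "X = Y"
  using assms by transfer (auto intro: extensionalityI)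

lemma length_indices: "is \<in> indices ds \<Longrightarrow> length is = length ds"
  by (simp add: indices_def list_all2_lengthD)

lemma Nil_in_indices [simp]: "[] \<in> indices ds \<longleftrightarrow> ds = []"
  by (simp add: indices_def)

lemma in_indices_Nil [simp]: "is \<in> indices [] \<longleftrightarrow> is = []"
  by (simp add: indices_def)

lemma Cons_in_indices [simp]: "i # is \<in> indices (d # ds) \<longleftrightarrow> i < d \<and> is \<in> indices ds"
  by (simp add: indices_def)

lemma append_in_indices:
  "length is = length ds \<Longrightarrow> is @ js \<in> indices (ds @ es) \<longleftrightarrow> is \<in> indices ds \<and> js \<in> indices es"
  by (simp add: indices_def list_all2_append)

text \<open>
  The combined index \<open>1 + (\<Sum>n=1..N. (i\<^sub>n - 1) * (\<Prod>j=1..n-1. I\<^sub>j))\<close>, shifted to start at \<open>0\<close>: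
  the first index varies fastest.
\<close>

definition combine :: "nat list \<Rightarrow> nat list \<Rightarrow> nat" where
  "combine ds is = (\<Sum>n<length is. is ! n * (\<Prod>j<n. ds ! j))"

definition split_index :: "nat list \<Rightarrow> nat \<Rightarrow> nat list" where
  "split_index ds = inv_into (indices ds) (combine ds)"

lemma combine_Nil [simp]: "combine ds [] = 0"
  by (simp add: combine_def)

lemma combine_Cons [simp]: "combine (d # ds) (i # is) = i + d * combine ds is"
  unfolding combine_def
  by (simp del: sum.lessThan_Suc prod.lessThan_Suc
      add: sum.lessThan_Suc_shift prod.lessThan_Suc_shift sum_distrib_left mult_ac)

lemma combine_less: "is \<in> indices ds \<Longrightarrow> combine ds is < prod_list ds"
proof (induction ds arbitrary: "is")
  case (Cons d ds)
  then obtain i js where "is": "is = i # js" "i < d" "js \<in> indices ds"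
    by (cases "is") auto
  have "combine (d # ds) is < d * Suc (combine ds js)"
    using "is" by simp
  also have "\<dots> \<le> d * prod_list ds"
    using Cons.IH[OF "is"(3)] by (intro mult_le_mono2) simp
  finally show ?case by simp
qed simp

lemma bij_betw_combine: "bij_betw (combine ds) (indices ds) {..<prod_list ds}"
proof (rule bij_betw_imageI)
  show "inj_on (combine ds) (indices ds)"
  proof (induction ds)
    case (Cons d ds)
    show ?case
    proof (rule inj_onI)
      fix x y assume x: "x \<in> indices (d # ds)" and y: "y \<in> indices (d # ds)"
        and eq: "combine (d # ds) x = combine (d # ds) y"
      obtain i xs where x': "x = i # xs" "i < d" "xs \<in> indices ds"
        using x by (cases x) auto
      obtain j ys where y': "y = j # ys" "j < d" "ys \<in> indices ds"
        using y by (cases y) auto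
      have e: "i + d * combine ds xs = j + d * combine ds ys"
        using eq x' y' by simp
      have "i = j"
        using arg_cong[OF e, of "\<lambda>k. k mod d"] x' y' by simp
      moreover have "combine ds xs = combine ds ys"
        using arg_cong[OF e, of "\<lambda>k. k div d"] x' y' by simp
      ultimately show "x = y"
        using Cons.IH x' y' by (auto dest: inj_onD)
    qed
  qed (simp add: inj_on_def)
  have "\<exists>is \<in> indices ds. combine ds is = k" if "k < prod_list ds" for k
    using that
  proof (induction ds arbitrary: k)
    case (Cons d ds)
    then have d: "d > 0" by (cases d) auto
    have "k div d < prod_list ds"
      using Cons.prems by (simp add: less_mult_imp_div_less mult.commute)
    then obtain js where "js \<in> indices ds" "combine ds js = k div d"
      using Cons.IH by blast
    then show ?case
      using d by (intro bexI[of _ "(k mod d) # js"]) auto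
  qed simp
  then show "combine ds ` indices ds = {..<prod_list ds}"
    using combine_less by blast
qed

lemma split_index_combine [simp]: "is \<in> indices ds \<Longrightarrow> split_index ds (combine ds is) = is"
  unfolding split_index_def using bij_betw_combine[of ds] by (simp add: bij_betw_inv_into_left)

lemma combine_split_index [simp]: "k < prod_list ds \<Longrightarrow> combine ds (split_index ds k) = k"
  unfolding split_index_def using bij_betw_combine[of ds] by (simp add: bij_betw_inv_into_right)

lemma split_index_in_indices: "k < prod_list ds \<Longrightarrow> split_index ds k \<in> indices ds"
  unfolding split_index_def using bij_betw_combine[of ds]
  by (metis bij_betw_def inv_into_into lessThan_iff)

definition lateral_slice :: "tensor \<Rightarrow> nat \<Rightarrow> real mat" where
  "lateral_slice X j = mat (dims X ! 0) (dims X ! 2) (\<lambda>(i, k). entry X [i, j, k])"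

definition subchain2 :: "tensor \<Rightarrow> tensor \<Rightarrow> tensor" where
  "subchain2 X Y =
    (let ds = [dims X ! 1, dims Y ! 1]
     in tensor [dims X ! 0, prod_list ds, dims Y ! 2]
          (\<lambda>is. let js = split_index ds (is ! 1)
                in (lateral_slice X (js ! 0) * lateral_slice Y (js ! 1)) $$ (is ! 0, is ! 2)))"

lemma lateral_slice_subchain2:
  assumes "dims X = [I1, J1, K]" "dims Y = [K, J2, I2]" "j1 < J1" "j2 < J2"
  shows "lateral_slice (subchain2 X Y) (combine [J1, J2] [j1, j2]) =
    lateral_slice X j1 * lateral_slice Y j2"
proof -
  have j: "[j1, j2] \<in> indices [J1, J2]"
    using assms by simp
  show ?thesis
    using assms split_index_combine[OF j] combine_less[OF j]
    by (intro eq_matI) (auto simp: lateral_slice_def subchain2_def)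
qed

text \<open>
  Mode-\<open>n\<close> unfolding, with the mode counted from \<open>1\<close> (\<open>1 \<le> n \<le> N\<close>). The columns are indexed by
  the combination of \<open>i\<^sub>n\<^sub>+\<^sub>1, \<dots>, i\<^sub>N, i\<^sub>1, \<dots>, i\<^sub>n\<^sub>-\<^sub>1\<close>, in this order.
\<close>

definition mode_unfolding :: "nat \<Rightarrow> tensor \<Rightarrow> real mat" where
  "mode_unfolding n X =
    (let ds = dims X; cs = drop n ds @ take (n - 1) ds
     in mat (ds ! (n - 1)) (prod_list cs)
          (\<lambda>(i, c). let js = split_index cs c
                    in entry X (drop (length ds - n) js @ [i] @ take (length ds - n) js)))"

lemma index_mode_unfolding:
  assumes n: "1 \<le> n" "n \<le> length (dims X)" and "is": "is \<in> indices (dims X)"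
  shows "mode_unfolding n X $$
      (is ! (n - 1), combine (drop n (dims X) @ take (n - 1) (dims X)) (drop n is @ take (n - 1) is))
    = entry X is"
proof -
  let ?ds = "dims X"
  have len: "length is = length ?ds"
    using length_indices[OF "is"] .
  have i: "is ! (n - 1) < ?ds ! (n - 1)"
    using "is" n len by (auto simp: indices_def list_all2_conv_all_nth)
  have m: "drop n is @ take (n - 1) is \<in> indices (drop n ?ds @ take (n - 1) ?ds)"
    using "is" len
    by (auto simp: append_in_indices) (auto simp: indices_def intro: list_all2_takeI list_all2_dropI)
  have "is = take (n - 1) is @ [is ! (n - 1)] @ drop n is"
    using n len id_take_nth_drop[of "n - 1" "is"] by simp
  then show ?thesis
    using i combine_less[OF m] split_index_combine[OF m] len
    by (auto simp: mode_unfolding_def Let_def)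
qed

definition n_unfolding :: "nat \<Rightarrow> tensor \<Rightarrow> real mat" where
  "n_unfolding n X =
    (let rs = take n (dims X); cs = drop n (dims X)
     in mat (prod_list rs) (prod_list cs)
          (\<lambda>(r, c). entry X (split_index rs r @ split_index cs c)))"

lemma index_n_unfolding:
  assumes "is": "is \<in> indices (dims X)"
  shows "n_unfolding n X $$
      (combine (take n (dims X)) (take n is), combine (drop n (dims X)) (drop n is)) = entry X is"
proof -
  have t: "take n is \<in> indices (take n (dims X))" and d: "drop n is \<in> indices (drop n (dims X))"
    using "is" by (auto simp: indices_def intro: list_all2_takeI list_all2_dropI)
  show ?thesis
    using combine_less[OF t] combine_less[OF d] t d by (simp add: n_unfolding_def Let_def)
qed

definition outer_product :: "tensor \<Rightarrow> tensor \<Rightarrow> tensor" where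
  "outer_product X Y = tensor (dims X @ dims Y)
    (\<lambda>is. entry X (take (length (dims X)) is) * entry Y (drop (length (dims X)) is))"

text \<open>
  The contracted product \<open>\<times>\<close> with subscript \<open>2,4\<close> and superscript \<open>1,3\<close> of fourth-order tensors:
  modes 2 and 4 of the first factor are contracted with modes 1 and 3 of the second.
\<close>

definition contract_24_13 :: "tensor \<Rightarrow> tensor \<Rightarrow> tensor" where
  "contract_24_13 X Y = tensor [dims X ! 0, dims Y ! 1, dims X ! 2, dims Y ! 3]
    (\<lambda>is. \<Sum>j<dims X ! 1. \<Sum>k<dims X ! 3.
       entry X [is ! 0, j, is ! 2, k] * entry Y [j, is ! 1, k, is ! 3])"

definition mat_tensor :: "real mat \<Rightarrow> tensor" where
  "mat_tensor M = tensor [dim_row M, dim_col M] (\<lambda>is. M $$ (is ! 0, is ! 1))"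

text \<open>
  Addition of tensors is only meaningful between tensors of equal dimensions, so the common
  dimensions of the summands are an explicit argument.
\<close>

definition tensor_sum :: "nat list \<Rightarrow> (nat \<Rightarrow> tensor) \<Rightarrow> nat set \<Rightarrow> tensor" where
  "tensor_sum ds T S = tensor ds (\<lambda>is. \<Sum>s\<in>S. entry (T s) is)"

end

theory Submission
  imports Defs
begin

text \<open>
  Both sides have rows indexed by pairs \<open>(l, i)\<close> in \<open>[L1] \<times> [I1]\<close> and columns indexed by pairs
  \<open>(m, p)\<close> in \<open>[L2] \<times> [I2]\<close>, so it suffices to compare the entries at such a pair of pairs. On
  the left, the inner dimension of the matrix product runs over the combined indices of
  \<open>(j, r)\<close> in \<open>[J] \<times> [R]\<close>, and each subchain product is a sum over its bond index, \<open>k\<close> in \<open>[K1]\<close>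
  or \<open>q\<close> in \<open>[K2]\<close>. The entry is therefore (\<open>index_gram_unfolding\<close>)

    \<open>\<Sum>j r. (\<Sum>k. A i j k * B k r l) * (\<Sum>q. C p j q * D q r m)\<close>.

  Once the bond indices are fixed, each summand separates into a factor depending on \<open>r\<close> and a
  factor depending on \<open>j\<close>, so this equals (\<open>sum_separate_bond_indices\<close>)

    \<open>\<Sum>k q. (\<Sum>r. B k r l * D q r m) * (\<Sum>j. A i j k * C p j q)\<close>.

  The two inner sums are entries of the two sums of outer products
  (\<open>entry_sum_outer_slices\<close>), and the sum over \<open>k\<close> and \<open>q\<close> is their contraction.
\<close>

lemma indices_two: "indices [a, b] = (\<lambda>(x, y). [x, y]) ` ({..<a} \<times> {..<b})"
proof
  show "indices [a, b] \<subseteq> (\<lambda>(x, y). [x, y]) ` ({..<a} \<times> {..<b})"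
    by (auto simp: indices_def list_all2_Cons2)
qed auto

lemma combine_two_less: "x < a \<Longrightarrow> y < b \<Longrightarrow> combine [a, b] [x, y] < a * b"
  using combine_less[of "[x, y]" "[a, b]"] by (simp del: combine_Cons)

lemma combine_two_cases:
  assumes "n < a * b"
  obtains x y where "x < a" "y < b" "n = combine [a, b] [x, y]"
proof -
  have n: "n < prod_list [a, b]"
    using assms by simp
  obtain x y where xy: "x < a" "y < b" "split_index [a, b] n = [x, y]"
    using split_index_in_indices[OF n]
    by (auto simp: indices_two simp del: in_indices_Nil Cons_in_indices)
  then show ?thesis
    using that combine_split_index[OF n] by metis
qed

lemma sum_combine_two:
  "(\<Sum>n<a * b. f n) = (\<Sum>x<a. \<Sum>y<b. f (combine [a, b] [x, y]))"
proof -
  have "(\<Sum>n<a * b. f n) = (\<Sum>xs \<in> indices [a, b]. f (combine [a, b] xs))"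
    using sum.reindex_bij_betw[OF bij_betw_combine[of "[a, b]"], of f] by simp
  also have "\<dots> = (\<Sum>(x, y) \<in> {..<a} \<times> {..<b}. f (combine [a, b] [x, y]))"
    unfolding indices_two
    by (subst sum.reindex) (auto simp: inj_on_def case_prod_beta simp del: combine_Cons)
  finally show ?thesis
    by (simp add: sum.cartesian_product del: combine_Cons)
qed

lemma dims_subchain2:
  "dims A = [I, J, K] \<Longrightarrow> dims B = [K, R, L] \<Longrightarrow> dims (subchain2 A B) = [I, J * R, L]"
  by (simp add: subchain2_def)

lemma entry_subchain2:
  assumes "dims A = [I, J, K]" "dims B = [K, R, L]" "i < I" "j < J" "r < R" "l < L"
  shows "entry (subchain2 A B) [i, combine [J, R] [j, r], l] =
    (\<Sum>k<K. entry A [i, j, k] * entry B [k, r, l])"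
proof -
  have "entry (subchain2 A B) [i, combine [J, R] [j, r], l] =
      lateral_slice (subchain2 A B) (combine [J, R] [j, r]) $$ (i, l)"
    using assms by (simp add: lateral_slice_def dims_subchain2)
  also have "\<dots> = (lateral_slice A j * lateral_slice B r) $$ (i, l)"
    using assms lateral_slice_subchain2 by metis
  also have "\<dots> = (\<Sum>k<K. entry A [i, j, k] * entry B [k, r, l])"
    using assms by (simp add: lateral_slice_def scalar_prod_def lessThan_atLeast0)
  finally show ?thesis .
qed

lemma dim_mode_unfolding_2:
  assumes "dims X = [I, M, L]"
  shows "dim_row (mode_unfolding 2 X) = M" "dim_col (mode_unfolding 2 X) = L * I"
  using assms by (simp_all add: mode_unfolding_def numeral_2_eq_2)

lemma index_mode_unfolding_2:
  assumes "dims X = [I, M, L]" "i < I" "n < M" "l < L"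
  shows "mode_unfolding 2 X $$ (n, combine [L, I] [l, i]) = entry X [i, n, l]"
  using index_mode_unfolding[of 2 X "[i, n, l]"] assms
  by (simp add: numeral_2_eq_2 del: combine_Cons)

text \<open>
  The rows of both unfoldings carry the same combined index \<open>(j, r)\<close>, so their product is summed
  over \<open>j\<close> and \<open>r\<close>, while each factor contributes a sum over its own bond index.
\<close>

lemma index_gram_unfolding:
  assumes A: "dims A = [I1, J, K1]" and B: "dims B = [K1, R, L1]"
    and C: "dims C = [I2, J, K2]" and D: "dims D = [K2, R, L2]"
    and less: "i < I1" "l < L1" "p < I2" "m < L2"
  shows "(transpose_mat (mode_unfolding 2 (subchain2 A B)) * mode_unfolding 2 (subchain2 C D)) $$
      (combine [L1, I1] [l, i], combine [L2, I2] [m, p]) =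
    (\<Sum>j<J. \<Sum>r<R. (\<Sum>k<K1. entry A [i, j, k] * entry B [k, r, l]) *
                  (\<Sum>q<K2. entry C [p, j, q] * entry D [q, r, m]))"
proof -
  let ?X = "subchain2 A B" and ?Y = "subchain2 C D"
  have X: "dims ?X = [I1, J * R, L1]" and Y: "dims ?Y = [I2, J * R, L2]"
    using A B C D by (simp_all add: dims_subchain2)
  have "(transpose_mat (mode_unfolding 2 ?X) * mode_unfolding 2 ?Y) $$
      (combine [L1, I1] [l, i], combine [L2, I2] [m, p]) =
    (\<Sum>n<J * R. mode_unfolding 2 ?X $$ (n, combine [L1, I1] [l, i]) *
                mode_unfolding 2 ?Y $$ (n, combine [L2, I2] [m, p]))"
    using combine_two_less[of l L1 i I1] combine_two_less[of m L2 p I2] less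
    by (simp add: dim_mode_unfolding_2[OF X] dim_mode_unfolding_2[OF Y] scalar_prod_def
        lessThan_atLeast0 del: combine_Cons)
  also have "\<dots> = (\<Sum>n<J * R. entry ?X [i, n, l] * entry ?Y [p, n, m])"
    using less by (simp add: index_mode_unfolding_2[OF X] index_mode_unfolding_2[OF Y]
        del: combine_Cons)
  also have "\<dots> = (\<Sum>j<J. \<Sum>r<R. (\<Sum>k<K1. entry A [i, j, k] * entry B [k, r, l]) *
                  (\<Sum>q<K2. entry C [p, j, q] * entry D [q, r, m]))"
    unfolding sum_combine_two using less
    by (simp add: entry_subchain2[OF A B] entry_subchain2[OF C D] del: combine_Cons)
  finally show ?thesis .
qed

text \<open>
  Transposing a slice exchanges the two outer modes of its tensor. For the right factors of the
  two subchain products this puts the bond indices into modes 2 and 4 of the sum of outer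
  products, and for the left factors into modes 1 and 3: exactly the modes that are contracted.
\<close>

lemma entry_sum_outer_slices:
  assumes "dims X = [a, n, b]" "dims Y = [c, n, d]" "x < b" "y < a" "z < d" "w < c"
  shows "entry (tensor_sum [b, a, d, c]
      (\<lambda>s. outer_product (mat_tensor (transpose_mat (lateral_slice X s)))
                         (mat_tensor (transpose_mat (lateral_slice Y s)))) {..<n}) [x, y, z, w] =
    (\<Sum>s<n. entry X [y, s, x] * entry Y [w, s, z])"
  using assms
  by (simp add: tensor_sum_def outer_product_def mat_tensor_def lateral_slice_def)

lemma index_n_unfolding_2:
  assumes "dims X = [a, b, c, d]" "x < a" "y < b" "z < c" "w < d"
  shows "n_unfolding 2 X $$ (combine [a, b] [x, y], combine [c, d] [z, w]) = entry X [x, y, z, w]"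
  using index_n_unfolding[of "[x, y, z, w]" X 2] assms
  by (simp add: numeral_2_eq_2 del: combine_Cons)

lemma sum_separate_bond_indices:
  fixes a b c d :: "nat \<Rightarrow> nat \<Rightarrow> 'a :: comm_semiring_0"
  shows "(\<Sum>j<J. \<Sum>r<R. (\<Sum>k<K. a j k * b r k) * (\<Sum>q<Q. c j q * d r q)) =
    (\<Sum>k<K. \<Sum>q<Q. (\<Sum>r<R. b r k * d r q) * (\<Sum>j<J. a j k * c j q))"
proof -
  let ?g = "\<lambda>j r k q. (b r k * d r q) * (a j k * c j q)"
  have "(\<Sum>j<J. \<Sum>r<R. (\<Sum>k<K. a j k * b r k) * (\<Sum>q<Q. c j q * d r q)) =
      (\<Sum>j<J. \<Sum>r<R. \<Sum>k<K. \<Sum>q<Q. ?g j r k q)"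
    by (simp add: sum_product mult_ac)
  \<comment> \<open>Pinning the outer index set orients the exchange: here the sum over \<open>r\<close> moves inwards, and
    in the next step the sum over \<open>j\<close>.\<close>
  also have "\<dots> = (\<Sum>j<J. \<Sum>k<K. \<Sum>q<Q. \<Sum>r<R. ?g j r k q)"
    by (simp add: sum.swap[of _ _ "{..<R}"])
  also have "\<dots> = (\<Sum>k<K. \<Sum>q<Q. \<Sum>j<J. \<Sum>r<R. ?g j r k q)"
    by (simp add: sum.swap[of _ _ "{..<J}"])
  also have "\<dots> = (\<Sum>k<K. \<Sum>q<Q. \<Sum>r<R. \<Sum>j<J. ?g j r k q)"
    by (intro sum.cong refl sum.swap)
  also have "\<dots> = (\<Sum>k<K. \<Sum>q<Q. (\<Sum>r<R. b r k * d r q) * (\<Sum>j<J. a j k * c j q))"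
    by (simp add: sum_product)
  finally show ?thesis .
qed

theorem proposition3p1:
  fixes A B C D :: tensor
    and I1 I2 J R K1 K2 L1 L2 :: nat
  assumes "0 < I1" "0 < I2" "0 < J" "0 < R" "0 < K1" "0 < K2" "0 < L1" "0 < L2"
    and "dims A = [I1, J, K1]"
    and "dims B = [K1, R, L1]"
    and "dims C = [I2, J, K2]"
    and "dims D = [K2, R, L2]"
  shows "transpose_mat (mode_unfolding 2 (subchain2 A B)) * mode_unfolding 2 (subchain2 C D) =
    n_unfolding 2
      (contract_24_13
        (tensor_sum [L1, K1, L2, K2]
          (\<lambda>r. outer_product (mat_tensor (transpose_mat (lateral_slice B r)))
                             (mat_tensor (transpose_mat (lateral_slice D r)))) {..<R})
        (tensor_sum [K1, I1, K2, I2]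
          (\<lambda>j. outer_product (mat_tensor (transpose_mat (lateral_slice A j)))
                             (mat_tensor (transpose_mat (lateral_slice C j)))) {..<J}))"
proof -
  note A = \<open>dims A = [I1, J, K1]\<close> and B = \<open>dims B = [K1, R, L1]\<close>
    and C = \<open>dims C = [I2, J, K2]\<close> and D = \<open>dims D = [K2, R, L2]\<close>
  define S where "S = tensor_sum [L1, K1, L2, K2]
    (\<lambda>r. outer_product (mat_tensor (transpose_mat (lateral_slice B r)))
                       (mat_tensor (transpose_mat (lateral_slice D r)))) {..<R}"
  define T where "T = tensor_sum [K1, I1, K2, I2]
    (\<lambda>j. outer_product (mat_tensor (transpose_mat (lateral_slice A j)))
                       (mat_tensor (transpose_mat (lateral_slice C j)))) {..<J}"
  have dims_S: "dims S = [L1, K1, L2, K2]" and dims_T: "dims T = [K1, I1, K2, I2]"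
    by (simp_all add: S_def T_def tensor_sum_def)
  have dims_contract: "dims (contract_24_13 S T) = [L1, I1, L2, I2]"
    using dims_S dims_T by (simp add: contract_24_13_def)
  have dims_AB: "dims (subchain2 A B) = [I1, J * R, L1]"
    and dims_CD: "dims (subchain2 C D) = [I2, J * R, L2]"
    using A B C D by (simp_all add: dims_subchain2)
  let ?G = "transpose_mat (mode_unfolding 2 (subchain2 A B)) * mode_unfolding 2 (subchain2 C D)"
  let ?N = "n_unfolding 2 (contract_24_13 S T)"
  have dim_N: "dim_row ?N = L1 * I1" "dim_col ?N = L2 * I2"
    using dims_contract by (simp_all add: n_unfolding_def numeral_2_eq_2)
  have "?G = ?N"
  proof (rule eq_matI)
    show "dim_row ?G = dim_row ?N" "dim_col ?G = dim_col ?N"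
      by (simp_all add: dim_N dim_mode_unfolding_2[OF dims_AB] dim_mode_unfolding_2[OF dims_CD])
  next
    fix u v assume "u < dim_row ?N" "v < dim_col ?N"
    then obtain l i m p where u: "u = combine [L1, I1] [l, i]" and v: "v = combine [L2, I2] [m, p]"
      and less: "l < L1" "i < I1" "m < L2" "p < I2"
      unfolding dim_N by (metis combine_two_cases)
    have "?N $$ (u, v) = entry (contract_24_13 S T) [l, i, m, p]"
      unfolding u v using less by (intro index_n_unfolding_2[OF dims_contract])
    also have "\<dots> = (\<Sum>k<K1. \<Sum>q<K2. entry S [l, k, m, q] * entry T [k, i, q, p])"
      using dims_S dims_T less by (simp add: contract_24_13_def)
    also have "\<dots> = (\<Sum>k<K1. \<Sum>q<K2. (\<Sum>r<R. entry B [k, r, l] * entry D [q, r, m]) *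
                                   (\<Sum>j<J. entry A [i, j, k] * entry C [p, j, q]))"
      unfolding S_def T_def using less
      by (simp add: entry_sum_outer_slices[OF B D] entry_sum_outer_slices[OF A C])
    also have "\<dots> = ?G $$ (u, v)"
      unfolding u v index_gram_unfolding[OF A B C D less(2,1,4,3)]
      by (rule sum_separate_bond_indices[symmetric])
    finally show "?G $$ (u, v) = ?N $$ (u, v)" ..
  qed
  then show ?thesis
    unfolding S_def T_def .
qed

end
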